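(* Let a non-degenerate probability distribution on $\mathbb{R}$ have finite moments $\mu_k$ of all orders $k=0,1,2,\ldots$. Then the sequence $\{\mu_k/k!\}_{k=0,1,2,\ldots}$ either contains infinitely many different terms or contains at most three different terms. In the latter case, there exist real numbers $a,b$ with $$b\ge 0,\qquad \frac{1-a-b}{2}\ge 0,\qquad \frac{1+a-b}{2}\ge 0,$$ such that the sequence $\{\mu_k/k!\}_{k\ge 0}$ has the form $\{1,a,1-b,a,1-b,a,1-b,\ldots\}$ (that is, $\mu_0=1$, and for all $k\ge 1$, $\mu_{2k-1}/(2k-1)!=a$ and $\mu_{2k}/(2k)!=1-b$), and the distribution has the characteristic function $$f(t)=\frac{1+iat+bt^2}{1+t^2},\qquad t\in\mathbb{R}.$$
   Context: For a probability distribution of a real random variable $X$, $\mu_k=\mathbb{E}[X^k]$ denotes its $k$-th moment and $f(t)=\mathbb{E}[e^{itX}]$, $t\in\mathbb{R}$, its characteristic function. A distribution is degenerate if it is concentrated at a single point, and non-degenerate otherwise. *)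

theory Defs
  imports "HOL-Probability.Probability"
begin

definition degenerate :: "real measure \<Rightarrow> bool" where
  "degenerate M \<longleftrightarrow> (\<exists>c. measure M {c} = 1)"

(* The Bochner integral is 0 for non-integrable integrands, so this is the k-th moment
   only where has_moment holds. *)
definition moment :: "real measure \<Rightarrow> nat \<Rightarrow> real" where
  "moment M k = (LINT x|M. x ^ k)"

definition has_moment :: "real measure \<Rightarrow> nat \<Rightarrow> bool" where
  "has_moment M k \<longleftrightarrow> integrable M (\<lambda>x. x ^ k)"

definition moment_terms :: "real measure \<Rightarrow> real set" where
  "moment_terms M = range (\<lambda>k. moment M k / fact k)"

end

theory Submission
  imports Defs "HOL-Complex_Analysis.Complex_Analysis" "HOL-Real_Asymp.Real_Asymp"
begin

text \<open>
  Write \<open>m k = \<mu> k / k!\<close>. If the sequence \<open>m\<close> has only finitely many different values, then every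
  inequality between finitely many of its terms that holds asymptotically, up to an error tending
  to \<open>0\<close>, holds exactly from some index on. The Cauchy--Schwarz inequality supplies such
  asymptotic inequalities. Applied to \<open>x ^ n\<close> and \<open>x ^ (n + 2)\<close> it says that
  \<open>(m (2 * n + 2))\<^sup>2 \<le> m (2 * n) * m (2 * n + 4)\<close> up to a factor tending to \<open>1\<close>, so the even terms
  are eventually log-convex, and a log-convex sequence with finitely many values is eventually
  constant. Once the even terms have a constant value other than \<open>0\<close>, the weight \<open>x ^ (2 * n)\<close>
  concentrates the mass of \<open>M\<close> near \<open>x = \<plusminus> 2 * n\<close>, where \<open>x\<^sup>2\<close> is nearly constant; a second use of
  Cauchy--Schwarz turns this into \<open>m (2 * n + 1) - m (2 * n + 3) \<longlonglongrightarrow> 0\<close>. Hence \<open>m\<close> is eventually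
  periodic with period \<open>2\<close>
  (\<open>normalized_moments_eventually_periodic\<close>).

  Boundedness of \<open>m\<close> makes the characteristic function \<open>f\<close> extend holomorphically to the strip
  \<open>\<bar>Im z\<bar> < 1\<close>, with Taylor coefficients \<open>\<i> ^ k * m k\<close> at \<open>0\<close>. Eventual periodicity says that
  \<open>(1 + z\<^sup>2) * f z\<close> has only finitely many nonzero coefficients, so it is a polynomial \<open>p\<close> on the
  unit disc, and on the strip by analytic continuation (\<open>one_plus_square_char_eq_poly\<close>). As
  \<open>\<bar>f t\<bar> \<le> 1\<close> for real \<open>t\<close>, the degree of \<open>p\<close> is at most \<open>2\<close>. The vanishing of its
  higher coefficients is the identity \<open>m (k + 2) = m k\<close> for all \<open>k \<ge> 1\<close>, and the remaining
  coefficients give the formula for \<open>f\<close> with \<open>a = m 1\<close> and \<open>b = 1 - m 2\<close>.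

  Of the sign conditions, \<open>\<bar>a\<bar> \<le> 1 - b\<close> is once more Cauchy--Schwarz in the limit of large moments.
  Since \<open>f t\<close> tends to \<open>b\<close> at infinity, \<open>b \<ge> 0\<close> follows from the fact that a positive definite
  function cannot stay below a negative constant far from the origin
  (\<open>char_not_eventually_negative\<close>).
\<close>

section \<open>Sequences with finitely many values\<close>

lemma finite_range_tendsto_imp_eventually_eq:
  fixes u :: "nat \<Rightarrow> real"
  assumes "finite (range u)" and "u \<longlonglongrightarrow> L"
  shows "\<forall>\<^sub>F n in sequentially. u n = L"
proof -
  have "open (- (range u - {L}))"
    using assms(1) by (intro open_Compl finite_imp_closed) auto
  then have "\<forall>\<^sub>F n in sequentially. u n \<in> - (range u - {L})"
    by (intro topological_tendstoD[OF assms(2)]) auto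
  then show ?thesis
    by eventually_elim auto
qed

text \<open>The principle by which an asymptotic inequality becomes exact: the negative parts of \<open>u\<close> tend to
  \<open>0\<close> and take finitely many values, so they eventually vanish.\<close>

lemma finite_range_eventually_nonneg:
  fixes u :: "nat \<Rightarrow> real"
  assumes fin: "finite (range u)" and nonneg: "\<And>n. v n \<ge> 0"
    and lim: "(\<lambda>n. u n - v n) \<longlonglongrightarrow> 0"
  shows "\<forall>\<^sub>F n in sequentially. u n \<ge> 0"
proof -
  have "(\<lambda>n. min (u n) 0) \<longlonglongrightarrow> 0"
  proof (rule tendsto_sandwich)
    show "(\<lambda>n. - \<bar>u n - v n\<bar>) \<longlonglongrightarrow> 0"
      using tendsto_minus[OF tendsto_rabs_zero[OF lim]] by simp
    show "\<forall>\<^sub>F n in sequentially. - \<bar>u n - v n\<bar> \<le> min (u n) 0"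
      using nonneg by (intro always_eventually) (smt (verit))
  qed auto
  moreover have "finite (range (\<lambda>n. min (u n) 0))"
    using finite_imageI[OF fin, of "\<lambda>x. min x 0"] by (simp add: image_image)
  ultimately have "\<forall>\<^sub>F n in sequentially. min (u n) 0 = 0"
    by (intro finite_range_tendsto_imp_eventually_eq)
  then show ?thesis
    by eventually_elim (simp add: min_def split: if_splits)
qed

lemma finite_range_binop:
  assumes "finite (range u)" and "finite (range v)"
  shows "finite (range (\<lambda>n. h (u n) (v n)))"
proof (rule finite_subset)
  show "finite (case_prod h ` (range u \<times> range v))" using assms by simp
qed auto

text \<open>Under log-convexity one strict increase forces the next one, and so infinitely many values.
  Hence the sequence is eventually decreasing.\<close>

lemma log_convex_finite_range_convergent:
  fixes u :: "nat \<Rightarrow> real"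
  assumes fin: "finite (range u)" and nonneg: "\<And>n. u n \<ge> 0"
    and lc: "\<forall>\<^sub>F n in sequentially. (u (Suc n))\<^sup>2 \<le> u n * u (Suc (Suc n))"
  shows "convergent u"
proof -
  obtain N where N: "\<And>n. n \<ge> N \<Longrightarrow> (u (Suc n))\<^sup>2 \<le> u n * u (Suc (Suc n))"
    using lc by (auto simp: eventually_sequentially)
  define w where "w n = u (n + N)" for n
  have finw: "finite (range w)"
    by (rule finite_subset[OF _ fin]) (auto simp: w_def)
  have w: "(w (Suc n))\<^sup>2 \<le> w n * w (Suc (Suc n))" for n
    using N[of "n + N"] by (simp add: w_def)
  have w0: "w n \<ge> 0" for n using nonneg by (simp add: w_def)
  have up: "w (Suc n) < w (Suc (Suc n))" if "w n < w (Suc n)" for n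
  proof (rule ccontr)
    assume "\<not> w (Suc n) < w (Suc (Suc n))"
    then have "w n * w (Suc (Suc n)) \<le> w n * w (Suc n)"
      using w0 by (intro mult_left_mono) auto
    also have "\<dots> < (w (Suc n))\<^sup>2"
      unfolding power2_eq_square using that w0[of n] by (intro mult_strict_right_mono) auto
    finally show False using w[of n] by simp
  qed
  have "w (Suc n) \<le> w n" for n
  proof (rule ccontr)
    assume "\<not> w (Suc n) \<le> w n"
    then have *: "w (n + k) < w (Suc (n + k))" for k
      by (induction k) (use up in \<open>auto\<close>)
    then have "strict_mono (\<lambda>k. w (n + k))"
      by (auto intro: strict_mono_Suc_iff[THEN iffD2])
    then have "infinite (range (\<lambda>k. w (n + k)))"
      by (intro range_inj_infinite strict_mono_imp_inj_on)
    then show False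
      using finw finite_subset[of "range (\<lambda>k. w (n + k))" "range w"] by auto
  qed
  then have "decseq w" by (rule decseq_SucI)
  moreover have "Bseq w"
    using finite_imp_bounded[OF finw] by (simp add: Bseq_eq_bounded)
  ultimately have "convergent w"
    by (intro Bseq_monoseq_convergent decseq_imp_monoseq)
  then show ?thesis
    unfolding w_def by (subst (asm) convergent_ignore_initial_segment)
qed

section \<open>Eventual periodicity of the normalized moments\<close>

text \<open>The quadratic form \<open>(s, t) \<mapsto> E (s F + t G)\<^sup>2\<close> is nonnegative, hence so is its determinant.\<close>

lemma (in prob_space) Cauchy_Schwarz_expectation:
  fixes F G :: "'a \<Rightarrow> real"
  assumes F: "integrable M (\<lambda>x. (F x)\<^sup>2)" and G: "integrable M (\<lambda>x. (G x)\<^sup>2)"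
    and FG: "integrable M (\<lambda>x. F x * G x)"
  shows "(expectation (\<lambda>x. F x * G x))\<^sup>2 \<le> expectation (\<lambda>x. (F x)\<^sup>2) * expectation (\<lambda>x. (G x)\<^sup>2)"
proof -
  define A B C where "A = expectation (\<lambda>x. (F x)\<^sup>2)" and "B = expectation (\<lambda>x. F x * G x)"
    and "C = expectation (\<lambda>x. (G x)\<^sup>2)"
  have q: "s\<^sup>2 * A + 2 * s * t * B + t\<^sup>2 * C \<ge> 0" for s t :: real
  proof -
    have "0 \<le> expectation (\<lambda>x. (s * F x + t * G x)\<^sup>2)"
      by (intro integral_nonneg_AE) auto
    also have "(\<lambda>x. (s * F x + t * G x)\<^sup>2) =
        (\<lambda>x. s\<^sup>2 * (F x)\<^sup>2 + 2 * s * t * (F x * G x) + t\<^sup>2 * (G x)\<^sup>2)"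
      by (auto simp: fun_eq_iff algebra_simps power2_eq_square)
    also have "expectation \<dots> = s\<^sup>2 * A + 2 * s * t * B + t\<^sup>2 * C"
      using F G FG by (simp add: A_def B_def C_def)
    finally show ?thesis .
  qed
  have "A \<ge> 0" "C \<ge> 0" unfolding A_def C_def by (auto intro!: integral_nonneg_AE)
  have "B\<^sup>2 \<le> A * C"
  proof (cases "A = 0")
    case False
    with \<open>A \<ge> 0\<close> have "A > 0" by simp
    have "0 \<le> A * (A * C - B\<^sup>2)"
      using q[of "-B" A] by (simp add: algebra_simps power2_eq_square)
    then show ?thesis using \<open>A > 0\<close> by (simp add: zero_le_mult_iff)
  next
    case True
    have "B = 0"
    proof (rule ccontr)
      assume "B \<noteq> 0"
      \<comment> \<open>with \<open>A = 0\<close> the form at \<open>(s, 1)\<close> is \<open>2 s B + C\<close>; this \<open>s\<close> makes it \<open>- 1\<close>\<close>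
      then show False using q[of "- (C + 1) / (2 * B)" 1] True by (simp add: field_simps)
    qed
    then show ?thesis using True by simp
  qed
  then show ?thesis by (simp add: A_def B_def C_def)
qed

definition normalized_moment :: "real measure \<Rightarrow> nat \<Rightarrow> real" where
  "normalized_moment M k = moment M k / fact k"

lemma moment_eq: "moment M k = fact k * normalized_moment M k"
  by (simp add: normalized_moment_def)

lemma moment_terms_eq: "moment_terms M = range (normalized_moment M)"
  by (simp add: moment_terms_def normalized_moment_def[abs_def])

lemma even_moment_nonneg: "even k \<Longrightarrow> normalized_moment M k \<ge> 0"
  unfolding normalized_moment_def moment_def by (auto intro!: divide_nonneg_nonneg integral_nonneg_AE simp: zero_le_even_power)

lemma finite_range_normalized_moment_comp:
  assumes "finite (moment_terms M)"
  shows "finite (range (\<lambda>n. normalized_moment M (g n)))"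
  by (rule finite_subset[OF _ assms]) (auto simp: moment_terms_eq)

context real_distribution
begin

lemma moment_0 [simp]: "moment M 0 = 1"
  using prob_space by (simp add: moment_def)

lemma moment_square_le:
  assumes "\<And>k. has_moment M k"
  shows "(moment M (j + k))\<^sup>2 \<le> moment M (2 * j) * moment M (2 * k)"
  using Cauchy_Schwarz_expectation[of "\<lambda>x. x ^ j" "\<lambda>x. x ^ k"] assms
  by (simp add: moment_def has_moment_def flip: power_add power_mult) (simp add: mult.commute)

text \<open>Cauchy--Schwarz for \<open>x ^ n\<close> and \<open>x ^ (n + 2)\<close> gives this inequality for moments in place of
  normalized moments. Dividing by the factorials inserts the factor \<open>\<rho> n\<close> on the left, which tends
  to \<open>1\<close> and disappears because only finitely many values occur.\<close>

lemma even_normalized_moments_eventually_log_convex: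
  assumes mom: "\<And>k. has_moment M k" and fin: "finite (moment_terms M)"
  shows "\<forall>\<^sub>F n in sequentially. (normalized_moment M (2 * Suc n))\<^sup>2 \<le>
    normalized_moment M (2 * n) * normalized_moment M (2 * Suc (Suc n))"
proof -
  let ?m = "normalized_moment M"
  \<comment> \<open>the ratio of factorials \<open>((2 n + 2)!)\<^sup>2 / ((2 n)! (2 n + 4)!)\<close>\<close>
  define \<rho> where "\<rho> n = (2 * real n + 2) * (2 * real n + 1) / ((2 * real n + 4) * (2 * real n + 3))" for n
  obtain C where C: "\<And>k. \<bar>?m k\<bar> \<le> C"
    using finite_imp_bounded[OF fin] by (auto simp: bounded_iff moment_terms_eq)
  have "\<forall>\<^sub>F n in sequentially. ?m (2 * n) * ?m (2 * Suc (Suc n)) - (?m (2 * Suc n))\<^sup>2 \<ge> 0"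
  proof (rule finite_range_eventually_nonneg)
    show "finite (range (\<lambda>n. ?m (2 * n) * ?m (2 * Suc (Suc n)) - (?m (2 * Suc n))\<^sup>2))"
      by (intro finite_range_binop[where h = "\<lambda>x z. x - z\<^sup>2"] finite_range_binop[where h = "(*)"]
          finite_range_normalized_moment_comp[OF fin])
    show "0 \<le> ?m (2 * n) * ?m (2 * Suc (Suc n)) - \<rho> n * (?m (2 * Suc n))\<^sup>2" for n
    proof -
      have "(moment M (2 * Suc n))\<^sup>2 \<le> moment M (2 * n) * moment M (2 * Suc (Suc n))"
        using moment_square_le[OF mom, of n "Suc (Suc n)"] by (simp add: mult_2)
      moreover have "fact (2 * Suc n) = (2 * real n + 2) * (2 * real n + 1) * fact (2 * n)"
        "fact (2 * Suc (Suc n)) = (2 * real n + 4) * (2 * real n + 3) * (fact (2 * Suc n) :: real)"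
        by (simp_all add: algebra_simps)
      ultimately have "(fact (2 * n) * fact (2 * Suc n)) * ((2 * real n + 2) * (2 * real n + 1) * (?m (2 * Suc n))\<^sup>2)
          \<le> (fact (2 * n) * fact (2 * Suc n)) * ((2 * real n + 4) * (2 * real n + 3) * (?m (2 * n) * ?m (2 * Suc (Suc n))))"
        unfolding moment_eq by (simp only: power2_eq_square mult_ac)
      then have "(2 * real n + 2) * (2 * real n + 1) * (?m (2 * Suc n))\<^sup>2
          \<le> (2 * real n + 4) * (2 * real n + 3) * (?m (2 * n) * ?m (2 * Suc (Suc n)))"
        by (rule mult_left_le_imp_le) (simp del: fact_Suc mult_Suc_right)
      then have "(2 * real n + 2) * (2 * real n + 1) * (?m (2 * Suc n))\<^sup>2 / ((2 * real n + 4) * (2 * real n + 3))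
          \<le> ?m (2 * n) * ?m (2 * Suc (Suc n))"
        by (subst pos_divide_le_eq) (auto simp: mult_ac simp del: mult_Suc_right intro!: mult_pos_pos)
      then show ?thesis
        unfolding \<rho>_def by simp
    qed
    have "(\<lambda>n. C\<^sup>2 * (1 - \<rho> n)) \<longlonglongrightarrow> 0"
      unfolding \<rho>_def by real_asymp
    then show "(\<lambda>n. ?m (2 * n) * ?m (2 * Suc (Suc n)) - (?m (2 * Suc n))\<^sup>2 -
        (?m (2 * n) * ?m (2 * Suc (Suc n)) - \<rho> n * (?m (2 * Suc n))\<^sup>2)) \<longlonglongrightarrow> 0"
    proof (rule Lim_null_comparison[rotated], intro always_eventually allI)
      fix n
      have \<rho>: "\<rho> n \<le> 1" unfolding \<rho>_def by (simp add: divide_simps mult_mono)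
      have "norm (?m (2 * n) * ?m (2 * Suc (Suc n)) - (?m (2 * Suc n))\<^sup>2 -
          (?m (2 * n) * ?m (2 * Suc (Suc n)) - \<rho> n * (?m (2 * Suc n))\<^sup>2)) =
          \<bar>- ((?m (2 * Suc n))\<^sup>2 * (1 - \<rho> n))\<bar>"
        unfolding real_norm_def by (rule arg_cong[where f = abs]) (simp only: algebra_simps)
      also have "\<dots> = (?m (2 * Suc n))\<^sup>2 * (1 - \<rho> n)"
        using \<rho> by (simp only: abs_minus_cancel) (simp add: abs_mult)
      also have "\<dots> \<le> C\<^sup>2 * (1 - \<rho> n)"
        using \<rho> C[of "2 * Suc n"] by (intro mult_right_mono) (auto simp: abs_le_square_iff[symmetric])
      finally show "norm (?m (2 * n) * ?m (2 * Suc (Suc n)) - (?m (2 * Suc n))\<^sup>2 -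
        (?m (2 * n) * ?m (2 * Suc (Suc n)) - \<rho> n * (?m (2 * Suc n))\<^sup>2)) \<le> C\<^sup>2 * (1 - \<rho> n)" .
    qed
  qed
  then show ?thesis by eventually_elim simp
qed

text \<open>The even terms converge, so they are eventually equal to some \<open>c\<close>. For the odd terms apply
  Cauchy--Schwarz to \<open>F x = x ^ n * (1 - x\<^sup>2 / \<kappa>)\<close> and \<open>G x = x ^ (n + 1)\<close>. The constancy of the even
  terms makes \<open>E F\<^sup>2\<close> smaller than \<open>E (x ^ (2 * n))\<close> by a factor of order \<open>1 / n\<close>, while \<open>E (F * G)\<close>
  is a multiple of the difference of two successive odd terms.\<close>

lemma normalized_moments_eventually_periodic:
  assumes mom: "\<And>k. has_moment M k" and fin: "finite (moment_terms M)"
  shows "\<forall>\<^sub>F k in sequentially. normalized_moment M (k + 2) = normalized_moment M k"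
proof -
  let ?m = "normalized_moment M"
  have "convergent (\<lambda>n. ?m (2 * n))"
    using even_normalized_moments_eventually_log_convex[OF mom fin]
    by (intro log_convex_finite_range_convergent finite_range_normalized_moment_comp[OF fin] even_moment_nonneg) auto
  then obtain c where "(\<lambda>n. ?m (2 * n)) \<longlonglongrightarrow> c" by (auto simp: convergent_def)
  then have even: "\<forall>\<^sub>F n in sequentially. ?m (2 * n) = c"
    by (intro finite_range_tendsto_imp_eventually_eq finite_range_normalized_moment_comp[OF fin])
  then have even1: "\<forall>\<^sub>F n in sequentially. ?m (2 * n + 2) = c"
    and even2: "\<forall>\<^sub>F n in sequentially. ?m (2 * n + 4) = c"
    using sequentially_offset[OF even, of 1] sequentially_offset[OF even, of 2]
    by (simp_all add: eval_nat_numeral)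

  have odd_diff: "\<forall>\<^sub>F n in sequentially. (?m (2 * n + 1) - ?m (2 * n + 3))\<^sup>2 \<le>
      c\<^sup>2 * ((2 * real n + 2) / (2 * real n + 1) * ((4 * real n + 3) / ((2 * real n + 3) * (real n + 1))))"
    using even even1 even2
  proof eventually_elim
    case (elim n)
    define r :: real where "r = real n"
    have r: "r \<ge> 0" by (simp add: r_def)
    \<comment> \<open>\<open>\<kappa>\<close> is the ratio of \<open>(2 n + 3)!\<close> to \<open>(2 n + 1)!\<close>, so that the two odd normalized moments
      enter \<open>E (F * G)\<close> with exactly opposite weights\<close>
    define \<kappa> where "\<kappa> = (2 * r + 2) * (2 * r + 3)"
    define l where "l = 1 / \<kappa>"
    let ?F = "\<lambda>x::real. x ^ n * (1 - l * x\<^sup>2)" and ?G = "\<lambda>x::real. x ^ (n + 1)"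
    have int: "integrable M (\<lambda>x. x ^ k)" for k
      using mom by (simp add: has_moment_def)
    have F2: "(\<lambda>x. (?F x)\<^sup>2) = (\<lambda>x. x ^ (2 * n) - 2 * l * x ^ (2 * n + 2) + l\<^sup>2 * x ^ (2 * n + 4))"
      by (simp only: fun_eq_iff power_add power_even_eq)
        (simp add: algebra_simps power2_eq_square power3_eq_cube power4_eq_xxxx)
    have G2: "(\<lambda>x. (?G x)\<^sup>2) = (\<lambda>x. x ^ (2 * n + 2))"
      by (simp only: fun_eq_iff power_add power_even_eq)
        (simp add: algebra_simps power2_eq_square power3_eq_cube power4_eq_xxxx)
    have FG: "(\<lambda>x. ?F x * ?G x) = (\<lambda>x. x ^ (2 * n + 1) - l * x ^ (2 * n + 3))"
      by (simp only: fun_eq_iff power_add power_even_eq)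
        (simp add: algebra_simps power2_eq_square power3_eq_cube power4_eq_xxxx)
    have f: "fact (2 * n + 1) = (2 * r + 1) * fact (2 * n)"
      "fact (2 * n + 2) = (2 * r + 2) * (2 * r + 1) * fact (2 * n)"
      "fact (2 * n + 3) = (2 * r + 3) * (2 * r + 2) * (2 * r + 1) * fact (2 * n)"
      "fact (2 * n + 4) = (2 * r + 4) * (2 * r + 3) * (2 * r + 2) * (2 * r + 1) * (fact (2 * n) :: real)"
      by (simp_all add: r_def eval_nat_numeral algebra_simps)
    have "(moment M (2 * n + 1) - l * moment M (2 * n + 3))\<^sup>2 \<le>
        (moment M (2 * n) - 2 * l * moment M (2 * n + 2) + l\<^sup>2 * moment M (2 * n + 4)) * moment M (2 * n + 2)"
      using Cauchy_Schwarz_expectation[of ?F ?G] unfolding F2 G2 FG moment_def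
      by (simp only: int Bochner_Integration.integrable_add Bochner_Integration.integrable_diff
          Bochner_Integration.integral_add Bochner_Integration.integral_diff
          integrable_mult_right integral_mult_right_zero simp_thms)
    also have "moment M (2 * n + 1) - l * moment M (2 * n + 3) =
        fact (2 * n + 1) * (?m (2 * n + 1) - ?m (2 * n + 3))"
      unfolding moment_eq f l_def \<kappa>_def using r by (simp add: divide_simps) (simp add: algebra_simps)
    also have "moment M (2 * n + 2) = fact (2 * n) * (c * (2 * r + 2) * (2 * r + 1))"
      unfolding moment_eq f elim by simp
    also have "moment M (2 * n) - 2 * l * (fact (2 * n) * (c * (2 * r + 2) * (2 * r + 1))) + l\<^sup>2 * moment M (2 * n + 4)
        = fact (2 * n) * (c * ((4 * r + 3) / ((2 * r + 3) * (r + 1))))"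
    proof -
      have 1: "1 - 2 * l * ((2 * r + 2) * (2 * r + 1)) + l\<^sup>2 * ((2 * r + 4) * (2 * r + 3) * (2 * r + 2) * (2 * r + 1))
         = (4 * r + 3) / ((2 * r + 3) * (r + 1))"
        unfolding l_def \<kappa>_def power2_eq_square using r
        by (simp add: add_nonneg_eq_0_iff divide_simps) (simp add: algebra_simps)
      show ?thesis
        unfolding moment_eq f elim 1[symmetric] by (simp add: algebra_simps)
    qed
    finally have "(fact (2 * n))\<^sup>2 * ((2 * r + 1)\<^sup>2 * (?m (2 * n + 1) - ?m (2 * n + 3))\<^sup>2) \<le>
        (fact (2 * n))\<^sup>2 * (c\<^sup>2 * ((2 * r + 2) * (2 * r + 1) * ((4 * r + 3) / ((2 * r + 3) * (r + 1)))))"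
      unfolding f by (simp only: power_mult_distrib power2_eq_square mult_ac)
    then have "(2 * r + 1)\<^sup>2 * (?m (2 * n + 1) - ?m (2 * n + 3))\<^sup>2 \<le>
        c\<^sup>2 * ((2 * r + 2) * (2 * r + 1) * ((4 * r + 3) / ((2 * r + 3) * (r + 1))))"
      by (rule mult_left_le_imp_le) simp
    then have "(?m (2 * n + 1) - ?m (2 * n + 3))\<^sup>2 \<le>
        c\<^sup>2 * ((2 * r + 2) * (2 * r + 1) * ((4 * r + 3) / ((2 * r + 3) * (r + 1)))) / (2 * r + 1)\<^sup>2"
      using r by (subst pos_le_divide_eq) (auto simp: mult_ac)
    also have "\<dots> = c\<^sup>2 * ((2 * r + 2) / (2 * r + 1) * ((4 * r + 3) / ((2 * r + 3) * (r + 1))))"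
      using r by (simp add: power2_eq_square divide_simps)
    finally show ?case by (simp only: r_def)
  qed
  have "(\<lambda>n. ?m (2 * n + 1) - ?m (2 * n + 3)) \<longlonglongrightarrow> 0"
  proof -
    have "(\<lambda>n. c\<^sup>2 * ((2 * real n + 2) / (2 * real n + 1) * ((4 * real n + 3) / ((2 * real n + 3) * (real n + 1))))) \<longlonglongrightarrow> 0"
      by real_asymp
    then have "(\<lambda>n. (?m (2 * n + 1) - ?m (2 * n + 3))\<^sup>2) \<longlonglongrightarrow> 0"
      by (rule Lim_null_comparison[rotated]) (use odd_diff in eventually_elim, simp)
    then show ?thesis by simp
  qed
  moreover have "finite (range (\<lambda>n. ?m (2 * n + 1) - ?m (2 * n + 3)))"
    by (intro finite_range_binop[where h = "(-)"] finite_range_normalized_moment_comp[OF fin])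
  ultimately have odd: "\<forall>\<^sub>F n in sequentially. ?m (2 * n + 1) - ?m (2 * n + 3) = 0"
    by (intro finite_range_tendsto_imp_eventually_eq)
  show ?thesis
  proof (rule sequentially_even_odd)
    show "\<forall>\<^sub>F n in sequentially. ?m (2 * n + 2) = ?m (2 * n)"
      using even even1 by eventually_elim simp
    show "\<forall>\<^sub>F n in sequentially. ?m (2 * n + 1 + 2) = ?m (2 * n + 1)"
      using odd by eventually_elim (simp add: numeral_3_eq_3)
  qed
qed

end

section \<open>The characteristic function on a strip\<close>

text \<open>The characteristic function at complex arguments; its values are used only in the strip where
  the integral converges absolutely.\<close>

definition complex_char :: "real measure \<Rightarrow> complex \<Rightarrow> complex" where
  "complex_char M z = (CLINT x|M. exp (\<i> * z * of_real x))"

lemma complex_char_of_real: "complex_char M (of_real t) = char M t"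
  by (simp add: complex_char_def char_def mult_ac)

context real_distribution
begin

lemma integrable_abs_power:
  assumes "\<And>k. has_moment M k"
  shows "integrable M (\<lambda>x. \<bar>x\<bar> ^ k)"
  using integrable_abs[of M "\<lambda>x. x ^ k"] assms by (simp add: has_moment_def power_abs)

text \<open>An odd absolute moment is controlled by its two even neighbours through
  \<open>\<bar>x\<bar> \<le> (h + x\<^sup>2 / h) / 2\<close>. The choice \<open>h = k\<close> balances the two contributions, as \<open>(k + 1)!\<close>
  is about \<open>k\<^sup>2\<close> times \<open>(k - 1)!\<close>.\<close>

lemma absolute_moment_le:
  assumes mom: "\<And>k. has_moment M k" and C: "\<And>k. \<bar>normalized_moment M k\<bar> \<le> C"
  shows "(\<integral>x. \<bar>x\<bar> ^ k \<partial>M) \<le> 2 * C * fact k"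
proof (cases "even k")
  case True
  have "C \<ge> 0" using C[of 0] by linarith
  have "(\<integral>x. \<bar>x\<bar> ^ k \<partial>M) = moment M k"
    using True by (simp add: moment_def power_even_abs)
  also have "\<dots> \<le> fact k * C"
    unfolding moment_eq using C[of k] by (intro mult_left_mono) auto
  also have "\<dots> \<le> 2 * C * fact k" using \<open>C \<ge> 0\<close> by simp
  finally show ?thesis .
next
  case False
  then obtain j where k: "k = Suc j" "even j" by (cases k) auto
  have "C \<ge> 0" using C[of 0] by linarith
  define h where "h = real k"
  have h: "h > 0" by (simp add: h_def k)
  have int: "integrable M (\<lambda>x. x ^ k)" for k using mom by (simp add: has_moment_def)
  have "(\<integral>x. \<bar>x\<bar> ^ k \<partial>M) \<le> (\<integral>x. (h * x ^ j + x ^ (j + 2) / h) / 2 \<partial>M)"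
  proof (rule integral_mono)
    show "integrable M (\<lambda>x. \<bar>x\<bar> ^ k)" using mom by (rule integrable_abs_power)
    show "integrable M (\<lambda>x. (h * x ^ j + x ^ (j + 2) / h) / 2)"
      by (intro integrable_divide Bochner_Integration.integrable_add integrable_mult_right int)
    fix x :: real
    have "0 \<le> (h - \<bar>x\<bar>)\<^sup>2" by simp
    then have "\<bar>x\<bar> \<le> (h + x\<^sup>2 / h) / 2"
      using h by (simp add: field_simps power2_eq_square)
    then have "\<bar>x\<bar> ^ j * \<bar>x\<bar> \<le> \<bar>x\<bar> ^ j * ((h + x\<^sup>2 / h) / 2)"
      by (intro mult_left_mono) auto
    then show "\<bar>x\<bar> ^ k \<le> (h * x ^ j + x ^ (j + 2) / h) / 2"
      using k by (simp add: power_even_abs algebra_simps power2_eq_square)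
  qed
  also have "\<dots> = (h * moment M j + moment M (j + 2) / h) / 2"
    using int[of j] int[of "j + 2"] by (simp add: moment_def)
  also have "\<dots> \<le> (h * (fact j * C) + (fact (j + 2) * C) / h) / 2"
    unfolding moment_eq using C[of j] C[of "j + 2"] h
    by (intro divide_right_mono add_mono mult_left_mono) auto
  also have "\<dots> = C * fact k * (1 + (h + 1) / h) / 2"
    using h by (simp add: h_def k field_simps)
  also have "\<dots> \<le> C * fact k * 4 / 2"
    using \<open>C \<ge> 0\<close> h by (intro divide_right_mono mult_left_mono) (auto simp: h_def k field_simps)
  finally show ?thesis by simp
qed

text \<open>The expansion of \<open>exp (\<i> * (z - s) * x)\<close> may be integrated term by term because the absolute
  moments grow at most like \<open>k!\<close>. The radius of convergence is at least \<open>1\<close> at every real centre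
  \<open>s\<close>, since the factor \<open>exp (\<i> * s * x)\<close> has modulus \<open>1\<close>.\<close>

lemma complex_char_sums:
  assumes mom: "\<And>k. has_moment M k" and C: "\<And>k. \<bar>normalized_moment M k\<bar> \<le> C"
    and z: "norm (z - of_real s) < 1"
  shows "(\<lambda>k. (CLINT x|M. exp (\<i> * of_real (s * x)) * (\<i> * of_real x) ^ k / fact k) * (z - of_real s) ^ k)
    sums complex_char M z"
proof -
  define w where "w = z - of_real s"
  define g where "g k x = exp (\<i> * of_real (s * x)) * (\<i> * of_real x) ^ k / fact k * w ^ k" for k and x :: real
  have norm_g: "norm (g k x) = \<bar>x\<bar> ^ k * (norm w ^ k / fact k)" for k x
    by (simp add: g_def norm_mult norm_divide norm_power)
  have g_sums: "(\<lambda>k. g k x) sums exp (\<i> * z * of_real x)" for x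
  proof -
    have "(\<lambda>k. exp (\<i> * of_real (s * x)) * ((\<i> * w * of_real x) ^ k /\<^sub>R fact k)) sums
        (exp (\<i> * of_real (s * x)) * exp (\<i> * w * of_real x))"
      by (intro sums_mult exp_converges)
    also have "exp (\<i> * of_real (s * x)) * exp (\<i> * w * of_real x) = exp (\<i> * z * of_real x)"
      by (simp add: w_def flip: exp_add) (simp add: algebra_simps)
    also have "(\<lambda>k. exp (\<i> * of_real (s * x)) * ((\<i> * w * of_real x) ^ k /\<^sub>R fact k)) = (\<lambda>k. g k x)"
      by (simp add: fun_eq_iff g_def scaleR_conv_of_real power_mult_distrib field_simps)
    finally show ?thesis .
  qed
  have int: "integrable M (g k)" for k
  proof (rule Bochner_Integration.integrable_bound)
    show "integrable M (\<lambda>x. \<bar>x\<bar> ^ k * (norm w ^ k / fact k))"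
      using integrable_abs_power[OF mom] by simp
    show "g k \<in> borel_measurable M"
      unfolding g_def by (intro measurable_finite_borel) measurable
  qed (simp add: norm_g)
  have "(\<lambda>k. integral\<^sup>L M (g k)) sums (CLINT x|M. (\<Sum>k. g k x))"
  proof (rule sums_integral[OF int])
    have "summable (\<lambda>k. norm (g k x))" for x
    proof -
      have "summable (\<lambda>k. (\<bar>x\<bar> * norm w) ^ k /\<^sub>R fact k)"
        by (rule summable_exp_generic)
      then show ?thesis
        by (simp add: norm_g power_mult_distrib field_simps)
    qed
    then show "AE x in M. summable (\<lambda>k. norm (g k x))" by simp
    show "summable (\<lambda>k. \<integral>x. norm (g k x) \<partial>M)"
    proof (rule summable_comparison_test')
      show "summable (\<lambda>k. 2 * C * norm w ^ k)"
        using z by (intro summable_mult summable_geometric) (simp add: w_def)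
      fix k :: nat
      have "(\<integral>x. norm (g k x) \<partial>M) = (\<integral>x. \<bar>x\<bar> ^ k \<partial>M) * (norm w ^ k / fact k)"
        by (simp add: norm_g)
      also have "\<dots> \<le> 2 * C * fact k * (norm w ^ k / fact k)"
        by (intro mult_right_mono absolute_moment_le mom C) simp
      finally show "norm (\<integral>x. norm (g k x) \<partial>M) \<le> 2 * C * norm w ^ k"
        by simp
    qed
  qed
  also have "(CLINT x|M. (\<Sum>k. g k x)) = complex_char M z"
    unfolding complex_char_def using sums_unique[OF g_sums] by simp
  also have "(\<lambda>k. integral\<^sup>L M (g k)) =
      (\<lambda>k. (CLINT x|M. exp (\<i> * of_real (s * x)) * (\<i> * of_real x) ^ k / fact k) * (z - of_real s) ^ k)"
    unfolding g_def w_def by simp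
  finally show ?thesis .
qed

text \<open>The strip is the union of the discs of radius \<open>1\<close> with real centres.\<close>

lemma complex_char_holomorphic_on_strip:
  assumes mom: "\<And>k. has_moment M k" and C: "\<And>k. \<bar>normalized_moment M k\<bar> \<le> C"
  shows "complex_char M holomorphic_on {z. \<bar>Im z\<bar> < 1}"
proof -
  have "complex_char M holomorphic_on (\<Union>s::real. ball (of_real s) 1)"
  proof (rule holomorphic_on_UN_open)
    fix s :: real
    show "complex_char M holomorphic_on ball (of_real s) 1"
      by (rule power_series_holomorphic, rule complex_char_sums[OF mom C])
        (simp add: dist_norm norm_minus_commute)
  qed auto
  also have "(\<Union>s::real. ball (complex_of_real s) 1) = {z. \<bar>Im z\<bar> < 1}"
  proof safe
    fix s :: real and z assume "z \<in> ball (complex_of_real s) 1"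
    then show "\<bar>Im z\<bar> < 1"
      using abs_Im_le_cmod[of "z - of_real s"] by (simp add: dist_norm norm_minus_commute)
  next
    fix z assume "\<bar>Im z\<bar> < 1"
    then have "z \<in> ball (of_real (Re z)) 1"
      by (simp add: dist_norm cmod_def)
    then show "z \<in> (\<Union>s::real. ball (of_real s) 1)" by blast
  qed
  finally show ?thesis .
qed

lemma complex_char_maclaurin:
  assumes mom: "\<And>k. has_moment M k" and C: "\<And>k. \<bar>normalized_moment M k\<bar> \<le> C"
    and z: "norm z < 1"
  shows "(\<lambda>k. \<i> ^ k * of_real (normalized_moment M k) * z ^ k) sums complex_char M z"
proof -
  have "(CLINT x|M. (\<i> * of_real x) ^ k / fact k) = \<i> ^ k * of_real (normalized_moment M k)" for k
  proof -
    have "(CLINT x|M. (\<i> * of_real x) ^ k / fact k) = (CLINT x|M. (\<i> ^ k / fact k) * of_real (x ^ k))"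
      by (simp add: power_mult_distrib)
    also have "\<dots> = \<i> ^ k / fact k * of_real (moment M k)"
      unfolding moment_def integral_complex_of_real[symmetric]
      by (rule integral_mult_right_zero)
    finally show ?thesis by (simp add: normalized_moment_def)
  qed
  then show ?thesis
    using complex_char_sums[OF mom C, of z 0] z by simp
qed

text \<open>Multiplying the Taylor series at \<open>0\<close> by \<open>1 + z\<^sup>2\<close> produces the differences
  \<open>m k - m (k + 2)\<close>, up to powers of \<open>\<i>\<close>, and these vanish eventually.\<close>

lemma one_plus_square_char_eq_poly:
  assumes mom: "\<And>k. has_moment M k" and fin: "finite (moment_terms M)"
  obtains p where "\<And>t. (1 + (of_real t)\<^sup>2) * char M t = poly p (of_real t)"
    and "coeff p 0 = 1" and "coeff p 1 = \<i> * of_real (normalized_moment M 1)"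
    and "\<And>k. coeff p (k + 2) = \<i> ^ k * of_real (normalized_moment M k - normalized_moment M (k + 2))"
proof -
  let ?m = "normalized_moment M"
  obtain C where C: "\<And>k. \<bar>?m k\<bar> \<le> C"
    using finite_imp_bounded[OF fin] by (auto simp: bounded_iff moment_terms_eq)
  define c where "c k = \<i> ^ k * complex_of_real (?m k)" for k
  obtain N where N: "\<And>k. k \<ge> N \<Longrightarrow> ?m (k + 2) = ?m k"
    using normalized_moments_eventually_periodic[OF mom fin] by (auto simp: eventually_sequentially)
  define d where "d k = c k + c (k + 2)" for k
  have d_eq: "d k = \<i> ^ k * of_real (?m k - ?m (k + 2))" for k
    by (simp add: d_def c_def algebra_simps power2_eq_square)
  define q where "q = (\<Sum>k<N. monom (d k) k)"
  have coeff_q: "coeff q k = d k" for k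
    using N[of k] by (auto simp: q_def coeff_sum d_eq)
  define p where "p = pCons (c 0) (pCons (c 1) q)"

  have on_disc: "(1 + z\<^sup>2) * complex_char M z = poly p z" if z: "norm z < 1" for z
  proof -
    have S: "(\<lambda>k. c k * z ^ k) sums complex_char M z"
      unfolding c_def by (rule complex_char_maclaurin[OF mom C z])
    have "(\<lambda>k. c (k + 2) * z ^ (k + 2)) sums (complex_char M z - (\<Sum>k<2. c k * z ^ k))"
      using sums_split_initial_segment[OF S, of 2] .
    from sums_add[OF this sums_mult[OF S, of "z\<^sup>2"]]
    have "(\<lambda>k. d k * z ^ (k + 2)) sums ((1 + z\<^sup>2) * complex_char M z - (c 0 + c 1 * z))"
      by (simp add: d_def algebra_simps power2_eq_square lessThan_nat_numeral lessThan_Suc eval_nat_numeral)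
    moreover have "(\<lambda>k. d k * z ^ (k + 2)) sums (\<Sum>k<N. d k * z ^ (k + 2))"
      using N by (intro sums_finite) (auto simp: d_eq)
    ultimately have "(1 + z\<^sup>2) * complex_char M z - (c 0 + c 1 * z) = (\<Sum>k<N. d k * z ^ (k + 2))"
      by (rule sums_unique2)
    also have "\<dots> = z\<^sup>2 * poly q z"
      by (simp add: q_def poly_sum poly_monom sum_distrib_left power2_eq_square mult_ac)
    finally show ?thesis
      by (simp add: p_def algebra_simps power2_eq_square)
  qed
  have on_strip: "(1 + z\<^sup>2) * complex_char M z - poly p z = 0" if "\<bar>Im z\<bar> < 1" for z
  proof (rule analytic_continuation[where f = "\<lambda>z. (1 + z\<^sup>2) * complex_char M z - poly p z"
        and S = "{z. \<bar>Im z\<bar> < 1}" and U = "ball 0 1" and \<xi> = 0])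
    let ?S = "{z. \<bar>Im z\<bar> < 1}"
    have S: "?S = {z. Im z < 1} \<inter> {z. Im z > -1}" by auto
    show "(\<lambda>z. (1 + z\<^sup>2) * complex_char M z - poly p z) holomorphic_on ?S"
      by (intro holomorphic_intros complex_char_holomorphic_on_strip[OF mom C])
    show "open ?S" unfolding S by (intro open_Int open_halfspace_Im_lt open_halfspace_Im_gt)
    show "connected ?S" unfolding S
      by (intro convex_connected convex_Int convex_halfspace_Im_lt convex_halfspace_Im_gt)
    show "ball 0 1 \<subseteq> ?S" by (auto simp: dist_norm intro: le_less_trans[OF abs_Im_le_cmod])
    show "(0::complex) islimpt ball 0 1" by (intro interior_limit_point) simp
  qed (use that on_disc in \<open>auto simp: dist_norm\<close>)
  show ?thesis
  proof (rule that[of p])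
    show "(1 + (of_real t)\<^sup>2) * char M t = poly p (of_real t)" for t
      using on_strip[of "of_real t"] by (simp add: complex_char_of_real)
  qed (simp_all add: p_def c_def coeff_q d_eq normalized_moment_def eval_nat_numeral)
qed

end

section \<open>The rational form of the characteristic function\<close>

text \<open>Along the positive reals \<open>p t / t ^ n\<close> with \<open>n\<close> the degree tends to the leading coefficient; if
  \<open>n \<ge> 3\<close>, the bound makes this limit \<open>0\<close>.\<close>

lemma poly_bounded_by_square_imp_degree_le_2:
  fixes p :: "complex poly"
  assumes bound: "\<And>t :: real. norm (poly p (of_real t)) \<le> 1 + t\<^sup>2"
  shows "degree p \<le> 2"
proof (rule ccontr)
  assume "\<not> degree p \<le> 2"
  then have n: "degree p \<ge> 3" by simp
  define n where "n = degree p"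
  have "((\<lambda>t::real. \<Sum>i\<le>n. coeff p i * (of_real t ^ i / of_real t ^ n)) \<longlongrightarrow>
      (\<Sum>i\<le>n. if i = n then coeff p i else 0)) at_top"
  proof (intro tendsto_sum)
    fix i assume i: "i \<in> {..n}"
    have "((\<lambda>t::real. coeff p i * of_real (t ^ i / t ^ n)) \<longlongrightarrow>
        coeff p i * of_real (if i = n then 1 else 0)) at_top"
    proof (intro tendsto_intros)
      show "((\<lambda>t::real. t ^ i / t ^ n) \<longlongrightarrow> (if i = n then 1 else 0)) at_top"
      proof (cases "i = n")
        case True
        have "\<forall>\<^sub>F t::real in at_top. t ^ i / t ^ n = 1"
          using eventually_gt_at_top[of 0] by eventually_elim (use True in auto)
        then show ?thesis using True by (simp add: tendsto_eventually)
      next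
        case False
        with i have "i < n" by simp
        then show ?thesis using False by simp real_asymp
      qed
    qed
    then show "((\<lambda>t::real. coeff p i * (of_real t ^ i / of_real t ^ n)) \<longlongrightarrow>
      (if i = n then coeff p i else 0)) at_top"
      by (simp split: if_splits)
  qed
  also have "(\<lambda>t::real. \<Sum>i\<le>n. coeff p i * (of_real t ^ i / of_real t ^ n)) =
      (\<lambda>t. poly p (of_real t) / of_real t ^ n)"
    by (simp add: poly_altdef n_def sum_divide_distrib)
  also have "(\<Sum>i\<le>n. if i = n then coeff p i else 0) = coeff p n"
    by simp
  finally have "((\<lambda>t::real. poly p (of_real t) / of_real t ^ n) \<longlongrightarrow> coeff p n) at_top" .
  moreover have "((\<lambda>t::real. poly p (of_real t) / of_real t ^ n) \<longlongrightarrow> 0) at_top"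
  proof (rule Lim_null_comparison)
    show "\<forall>\<^sub>F t::real in at_top. norm (poly p (of_real t) / of_real t ^ n :: complex) \<le> (1 + t\<^sup>2) / t ^ 3"
      using eventually_ge_at_top[of 1]
    proof eventually_elim
      case (elim t)
      then have "t ^ 3 \<le> t ^ n" using n by (auto simp: n_def intro: power_increasing)
      then show ?case
        using elim bound[of t] by (auto simp: norm_divide norm_power intro!: frac_le)
    qed
    show "((\<lambda>t::real. (1 + t\<^sup>2) / t ^ 3) \<longlongrightarrow> 0) at_top" by real_asymp
  qed
  ultimately have "coeff p n = 0"
    by (rule tendsto_unique[OF trivial_limit_at_top_linorder])
  then show False using n by (auto simp: n_def)
qed

context real_distribution
begin

text \<open>The bound \<open>\<bar>f t\<bar> \<le> 1\<close> on the real line upgrades eventual periodicity to periodicity from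
  \<open>k = 1\<close> on: the polynomial \<open>(1 + t\<^sup>2) * f t\<close> has degree at most \<open>2\<close>, and the difference of the
  terms \<open>k\<close> and \<open>k + 2\<close> is, up to a power of \<open>\<i>\<close>, its coefficient of degree \<open>k + 2\<close>.\<close>

lemma normalized_moments_periodic:
  assumes mom: "\<And>k. has_moment M k" and fin: "finite (moment_terms M)" and "k \<ge> 1"
  shows "normalized_moment M (k + 2) = normalized_moment M k"
proof -
  obtain p where p: "\<And>t. (1 + (of_real t)\<^sup>2) * char M t = poly p (of_real t)"
    "coeff p 0 = 1" "coeff p 1 = \<i> * of_real (normalized_moment M 1)"
    "\<And>k. coeff p (k + 2) = \<i> ^ k * of_real (normalized_moment M k - normalized_moment M (k + 2))"
    by (rule one_plus_square_char_eq_poly[OF mom fin]) (rule that)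
  have "norm (poly p (of_real t)) \<le> 1 + t\<^sup>2" for t :: real
  proof -
    have "norm (1 + (of_real t)\<^sup>2 :: complex) = 1 + t\<^sup>2"
      using norm_of_real[of "1 + t\<^sup>2", where 'a = complex] by simp
    moreover have "norm (char M t) \<le> 1" by (rule cmod_char_le_1)
    ultimately show ?thesis
      unfolding p(1)[symmetric] norm_mult by (simp add: mult_left_le)
  qed
  then have "degree p \<le> 2"
    by (rule poly_bounded_by_square_imp_degree_le_2)
  then have "coeff p (k + 2) = 0"
    using \<open>k \<ge> 1\<close> by (intro coeff_eq_0) simp
  then have "normalized_moment M k - normalized_moment M (k + 2) = 0"
    unfolding p(4) by (simp only: mult_eq_0_iff power_eq_0_iff of_real_eq_0_iff) simp
  then show ?thesis by simp
qed

lemma odd_normalized_moment: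
  assumes mom: "\<And>k. has_moment M k" and fin: "finite (moment_terms M)"
  shows "normalized_moment M (2 * k + 1) = normalized_moment M 1"
proof (induction k)
  case (Suc k)
  then show ?case using normalized_moments_periodic[OF mom fin, of "2 * k + 1"] by simp
qed simp

lemma even_normalized_moment:
  assumes mom: "\<And>k. has_moment M k" and fin: "finite (moment_terms M)"
  shows "normalized_moment M (2 * k + 2) = normalized_moment M 2"
proof (induction k)
  case (Suc k)
  then show ?case using normalized_moments_periodic[OF mom fin, of "2 * k + 2"] by simp
qed (simp add: numeral_2_eq_2)

lemma char_eq_rational:
  assumes mom: "\<And>k. has_moment M k" and fin: "finite (moment_terms M)"
  shows "char M t = (1 + \<i> * of_real (normalized_moment M 1) * of_real t
    + of_real (1 - normalized_moment M 2) * (of_real t)\<^sup>2) / (1 + (of_real t)\<^sup>2)"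
proof -
  let ?m = "normalized_moment M"
  obtain p where p: "\<And>t. (1 + (of_real t)\<^sup>2) * char M t = poly p (of_real t)"
    "coeff p 0 = 1" "coeff p 1 = \<i> * of_real (?m 1)"
    "\<And>k. coeff p (k + 2) = \<i> ^ k * of_real (?m k - ?m (k + 2))"
    by (rule one_plus_square_char_eq_poly[OF mom fin]) (rule that)
  have "p = [:1, \<i> * of_real (?m 1), of_real (1 - ?m 2):]"
  proof (rule poly_eqI)
    fix k :: nat
    consider "k = 0" | "k = 1" | "k = 2" | "k \<ge> 3" by linarith
    then show "coeff p k = coeff [:1, \<i> * of_real (?m 1), of_real (1 - ?m 2):] k"
    proof cases
      case 3
      then show ?thesis using p(4)[of 0] by (simp add: normalized_moment_def eval_nat_numeral)
    next
      case 4
      define j where "j = k - 3"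
      have k: "k = Suc j + 2" using 4 by (simp add: j_def)
      have "coeff p k = 0"
        using normalized_moments_periodic[OF mom fin, of "Suc j"] unfolding k p(4) by simp
      then show ?thesis by (simp add: k)
    qed (use p in \<open>simp_all\<close>)
  qed
  then have "(1 + (of_real t)\<^sup>2) * char M t =
      1 + \<i> * of_real (?m 1) * of_real t + of_real (1 - ?m 2) * (of_real t)\<^sup>2"
    unfolding p(1) by (simp add: algebra_simps power2_eq_square)
  moreover have "1 + (of_real t)\<^sup>2 \<noteq> (0 :: complex)"
  proof -
    have "1 + t\<^sup>2 \<noteq> 0" using zero_le_power2[of t] by linarith
    then have "complex_of_real (1 + t\<^sup>2) \<noteq> 0" by (subst of_real_eq_0_iff)
    then show ?thesis by simp
  qed
  ultimately show ?thesis by (simp add: field_simps)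
qed

end

section \<open>The sign conditions\<close>

context real_distribution
begin

text \<open>The double sum is the expectation of \<open>\<bar>\<Sum>j. exp (\<i> * u j * x)\<bar>\<^sup>2\<close>.\<close>

lemma char_positive_definite:
  fixes u :: "nat \<Rightarrow> real"
  shows "(\<Sum>j<n. \<Sum>k<n. Re (char M (u j - u k))) \<ge> 0"
proof -
  have eq: "(\<Sum>j<n. \<Sum>k<n. iexp ((u j - u k) * x)) = of_real ((norm (\<Sum>j<n. iexp (u j * x)))\<^sup>2)" for x
  proof -
    have "complex_of_real ((norm (\<Sum>j<n. iexp (u j * x)))\<^sup>2) =
        (\<Sum>j<n. iexp (u j * x)) * cnj (\<Sum>j<n. iexp (u j * x))"
      by (simp only: complex_norm_square)
    also have "\<dots> = (\<Sum>j<n. \<Sum>k<n. iexp (u j * x) * cnj (iexp (u k * x)))"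
      by (simp add: sum_product)
    also have "\<dots> = (\<Sum>j<n. \<Sum>k<n. iexp ((u j - u k) * x))"
      by (intro sum.cong refl) (simp add: exp_cnj algebra_simps flip: exp_add)
    finally show ?thesis ..
  qed
  have int: "integrable M (\<lambda>x. iexp ((u j - u k) * x))" for j k
    by (intro integrable_iexp) auto
  have "(\<Sum>j<n. \<Sum>k<n. char M (u j - u k)) = (CLINT x|M. (\<Sum>j<n. \<Sum>k<n. iexp ((u j - u k) * x)))"
    unfolding char_def using int by (simp add: Bochner_Integration.integral_sum)
  also have "\<dots> = of_real (\<integral>x. (norm (\<Sum>j<n. iexp (u j * x)))\<^sup>2 \<partial>M)"
    unfolding eq by (rule integral_complex_of_real)
  finally have "Re (\<Sum>j<n. \<Sum>k<n. char M (u j - u k)) = (\<integral>x. (norm (\<Sum>j<n. iexp (u j * x)))\<^sup>2 \<partial>M)"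
    by simp
  also have "\<dots> \<ge> 0" by (intro integral_nonneg_AE) auto
  finally show ?thesis by simp
qed

text \<open>Take \<open>n\<close> points with spacing \<open>T\<close>. In the sum of positive definiteness the \<open>n\<close> diagonal terms are
  \<open>1\<close> and the \<open>n * (n - 1)\<close> others are at most \<open>b\<close>, so a large \<open>n\<close> makes it negative.\<close>

lemma char_not_eventually_negative:
  assumes b: "b < 0" and T: "T > 0" and neg: "\<And>t. \<bar>t\<bar> \<ge> T \<Longrightarrow> Re (char M t) \<le> b"
  shows False
proof -
  obtain n :: nat where n: "1 / - b + 1 < real n" using reals_Archimedean2 by blast
  have "1 / - b > 0" using b by simp
  with n have n1: "real n > 1" by linarith
  have "(\<Sum>j<n. \<Sum>k<n. Re (char M (real j * T - real k * T))) \<le> (\<Sum>j<n. \<Sum>k<n. if k = j then 1 else b)"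
  proof (intro sum_mono)
    fix j k
    have "T \<le> \<bar>real j * T - real k * T\<bar>" if "k \<noteq> j"
    proof -
      have "1 \<le> \<bar>real j - real k\<bar>" using that by linarith
      then have "1 * T \<le> \<bar>real j - real k\<bar> * T" using T by (intro mult_right_mono) auto
      also have "\<dots> = \<bar>real j * T - real k * T\<bar>"
        using T by (simp add: abs_mult flip: left_diff_distrib)
      finally show ?thesis by simp
    qed
    then show "Re (char M (real j * T - real k * T)) \<le> (if k = j then 1 else b)"
      using neg by (simp add: char_zero)
  qed
  also have "\<dots> = (\<Sum>j<n. 1 + (real n - 1) * b)"
  proof (intro sum.cong refl)
    fix j assume j: "j \<in> {..<n}"
    have "(\<Sum>k<n. if k = j then 1 else b) = (\<Sum>k<n. b + (if k = j then 1 - b else 0))"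
      by (intro sum.cong) auto
    also have "\<dots> = 1 + (real n - 1) * b"
      using j by (simp add: sum.distrib algebra_simps)
    finally show "(\<Sum>k<n. if k = j then 1 else b) = 1 + (real n - 1) * b" .
  qed
  also have "\<dots> = real n * (1 + (real n - 1) * b)" by simp
  also have "\<dots> < 0"
  proof -
    have "1 < (real n - 1) * - b" using n b by (simp add: field_simps)
    then show ?thesis using n1 by (simp add: mult_pos_neg)
  qed
  finally show False using char_positive_definite[where n = n and u = "\<lambda>j. real j * T"] by simp
qed

text \<open>Otherwise \<open>Re (f t)\<close>, which tends to \<open>b = 1 - m 2\<close> at infinity, would eventually stay below
  \<open>b / 2 < 0\<close>.\<close>

lemma second_normalized_moment_le_1:
  assumes mom: "\<And>k. has_moment M k" and fin: "finite (moment_terms M)"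
  shows "normalized_moment M 2 \<le> 1"
proof (rule ccontr)
  define b where "b = 1 - normalized_moment M 2"
  assume "\<not> ?thesis"
  then have b: "b < 0" by (simp add: b_def)
  have Re: "Re (char M t) = b + (1 - b) / (1 + t\<^sup>2)" for t
  proof -
    have [simp]: "1 + (of_real t)\<^sup>2 = complex_of_real (1 + t\<^sup>2)" by simp
    have pos: "1 + t\<^sup>2 > 0" by (simp add: add_pos_nonneg)
    have "Re (char M t) = (1 + b * t\<^sup>2) / (1 + t\<^sup>2)"
      unfolding char_eq_rational[OF mom fin] b_def[symmetric]
      by (simp del: of_real_add of_real_power of_real_diff add: Re_divide_of_real power2_eq_square)
    also have "\<dots> = b + (1 - b) / (1 + t\<^sup>2)"
      using pos by (simp add: field_simps)
    finally show ?thesis .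
  qed
  \<comment> \<open>the solution of \<open>(1 - b) / T\<^sup>2 = - b / 2\<close>\<close>
  define T where "T = sqrt (2 * (1 - b) / - b)"
  show False
  proof (rule char_not_eventually_negative)
    show "b / 2 < 0" using b by simp
    show "T > 0" using b unfolding T_def by (auto intro!: divide_pos_neg mult_pos_pos)
    fix t assume "T \<le> \<bar>t\<bar>"
    then have "2 * (1 - b) / - b \<le> t\<^sup>2"
      unfolding T_def by (metis real_sqrt_abs real_sqrt_le_iff)
    then have "(1 - b) / (1 + t\<^sup>2) \<le> - b / 2"
      using b by (simp add: field_simps add_pos_nonneg)
    then show "Re (char M t) \<le> b / 2" unfolding Re by linarith
  qed
qed

text \<open>Cauchy--Schwarz for the low moments loses a constant factor. By periodicity it may be applied to
  arbitrarily high moments instead, where the ratio of the factorials tends to \<open>1\<close>.\<close>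

lemma abs_first_normalized_moment_le_second:
  assumes mom: "\<And>k. has_moment M k" and fin: "finite (moment_terms M)"
  shows "\<bar>normalized_moment M 1\<bar> \<le> normalized_moment M 2"
proof -
  let ?m = "normalized_moment M"
  note odd = odd_normalized_moment[OF mom fin] and even = even_normalized_moment[OF mom fin]
  have "(?m 1)\<^sup>2 \<le> (?m 2)\<^sup>2 * ((2 * real n + 4) / (2 * real n + 3))" for n :: nat
  proof -
    have "(moment M (2 * n + 3))\<^sup>2 \<le> moment M (2 * n + 2) * moment M (2 * n + 4)"
      using moment_square_le[OF mom, of "n + 1" "n + 2"] by (simp add: eval_nat_numeral)
    moreover have "moment M (2 * n + 3) = (2 * real n + 3) * fact (2 * n + 2) * ?m 1"
      using odd[of "n + 1"] by (simp add: moment_eq eval_nat_numeral algebra_simps)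
    moreover have "moment M (2 * n + 2) = fact (2 * n + 2) * ?m 2"
      using even by (simp only: moment_eq)
    moreover have "moment M (2 * n + 4) = (2 * real n + 4) * (2 * real n + 3) * fact (2 * n + 2) * ?m 2"
      using even[of "n + 1"] by (simp add: moment_eq eval_nat_numeral algebra_simps)
    ultimately have "(fact (2 * n + 2))\<^sup>2 * (2 * real n + 3) * ((2 * real n + 3) * (?m 1)\<^sup>2) \<le>
        (fact (2 * n + 2))\<^sup>2 * (2 * real n + 3) * ((2 * real n + 4) * (?m 2)\<^sup>2)"
      by (simp only: power2_eq_square mult_ac)
    then have "(2 * real n + 3) * (?m 1)\<^sup>2 \<le> (2 * real n + 4) * (?m 2)\<^sup>2"
      by (simp add: mult_le_cancel_left)
    then show ?thesis by (simp add: field_simps)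
  qed
  moreover have "(\<lambda>n::nat. (?m 2)\<^sup>2 * ((2 * real n + 4) / (2 * real n + 3))) \<longlonglongrightarrow> (?m 2)\<^sup>2"
    by real_asymp
  ultimately have "(?m 1)\<^sup>2 \<le> (?m 2)\<^sup>2"
    by (intro LIMSEQ_le_const) auto
  then show ?thesis
    using even_moment_nonneg[of 2 M] by (simp flip: abs_le_square_iff)
qed

end

section \<open>The dichotomy\<close>

theorem theorem1p1:
  fixes M :: "real measure"
  assumes "real_distribution M"
    and "\<not> degenerate M"
    and "\<And>k. has_moment M k"
  shows "(infinite (moment_terms M) \<or> (finite (moment_terms M) \<and> card (moment_terms M) \<le> 3)) \<and>
    (finite (moment_terms M) \<and> card (moment_terms M) \<le> 3 \<longrightarrow>
      (\<exists>a b :: real.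
        b \<ge> 0 \<and> (1 - a - b) / 2 \<ge> 0 \<and> (1 + a - b) / 2 \<ge> 0 \<and>
        moment M 0 = 1 \<and>
        (\<forall>k\<ge>1. moment M (2 * k - 1) / fact (2 * k - 1) = a \<and>
               moment M (2 * k) / fact (2 * k) = 1 - b) \<and>
        (\<forall>t :: real. char M t =
          (1 + \<i> * of_real a * of_real t + of_real b * (of_real t)\<^sup>2) / (1 + (of_real t)\<^sup>2))))"
proof -
  interpret real_distribution M by fact
  let ?m = "normalized_moment M"
  note mom = assms(3)
  have odd: "?m (2 * k - 1) = ?m 1" and even: "?m (2 * k) = ?m 2"
    if "finite (moment_terms M)" and "k \<ge> 1" for k
  proof -
    obtain j where k: "k = Suc j" using \<open>k \<ge> 1\<close> by (cases k) auto
    show "?m (2 * k - 1) = ?m 1" "?m (2 * k) = ?m 2"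
      using odd_normalized_moment[OF mom that(1), of j] even_normalized_moment[OF mom that(1), of j]
      by (simp_all add: k)
  qed
  have card: "card (moment_terms M) \<le> 3" if fin: "finite (moment_terms M)"
  proof -
    have "?m k \<in> {1, ?m 1, ?m 2}" for k
    proof (cases "k = 0")
      case True
      then show ?thesis by (simp add: normalized_moment_def)
    next
      case False
      show ?thesis
      proof (cases "even k")
        case True
        with False obtain j where "k = 2 * j" "j \<ge> 1" by (auto elim!: evenE)
        then show ?thesis using even[OF fin] by simp
      next
        case False
        then obtain j where "k = 2 * Suc j - 1" by (auto elim!: oddE)
        then show ?thesis using odd[OF fin, of "Suc j"] by simp
      qed
    qed
    then have "moment_terms M \<subseteq> {1, ?m 1, ?m 2}" by (auto simp: moment_terms_eq)
    then have "card (moment_terms M) \<le> card {1, ?m 1, ?m 2}" by (intro card_mono) auto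
    also have "\<dots> \<le> 3" by (simp add: card_insert_if)
    finally show ?thesis .
  qed
  have "\<exists>a b. b \<ge> 0 \<and> (1 - a - b) / 2 \<ge> 0 \<and> (1 + a - b) / 2 \<ge> 0 \<and> moment M 0 = 1 \<and>
      (\<forall>k\<ge>1. moment M (2 * k - 1) / fact (2 * k - 1) = a \<and> moment M (2 * k) / fact (2 * k) = 1 - b) \<and>
      (\<forall>t :: real. char M t =
        (1 + \<i> * of_real a * of_real t + of_real b * (of_real t)\<^sup>2) / (1 + (of_real t)\<^sup>2))"
    if fin: "finite (moment_terms M)"
  proof (intro exI conjI allI impI)
    show "1 - ?m 2 \<ge> 0" using second_normalized_moment_le_1[OF mom fin] by simp
    show "(1 - ?m 1 - (1 - ?m 2)) / 2 \<ge> 0" "(1 + ?m 1 - (1 - ?m 2)) / 2 \<ge> 0"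
      using abs_first_normalized_moment_le_second[OF mom fin] by (simp_all add: abs_le_iff)
    show "moment M 0 = 1" by simp
    show "moment M (2 * k - 1) / fact (2 * k - 1) = ?m 1"
      "moment M (2 * k) / fact (2 * k) = 1 - (1 - ?m 2)" if "k \<ge> 1" for k
      using odd[OF fin that] even[OF fin that] by (simp_all add: normalized_moment_def)
    show "char M t = (1 + \<i> * of_real (?m 1) * of_real t + of_real (1 - ?m 2) * (of_real t)\<^sup>2)
      / (1 + (of_real t)\<^sup>2)" for t
      by (rule char_eq_rational[OF mom fin])
  qed
  with card show ?thesis by blast
qed

end
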